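(* There is a universal constant $\varkappa>0$ such that the following holds. Let $\bar d\ge1$, $d=2\bar d$, let $\chi$ be a probability distribution on $[0,1]^{\bar d}$ and let $D$ be a database of $n$ i.i.d. samples from $\chi$. For $i\in\{S,C\}$ let $f^i_D$ be the \texttt{SUM} ($i=S$) or \texttt{COUNT} ($i=C$) observed query function and $f^i_\chi(\mathbf{q})=\mathbb{E}_{D\sim\chi}[f^i_D(\mathbf{q})]$ the corresponding distribution query function. Then for every $\varepsilon_2>0$ and $i\in\{S,C\}$, $$\mathbb{P}_{D\sim\chi}\Big[\tfrac1n\big\|f^i_\chi-f^i_D\big\|_\infty>\varepsilon_2\Big]\le\varkappa^{d+1}\,d\,\varepsilon_2^{-d}\exp\!\big(-\varkappa^{-1}\varepsilon_2^2 n\big).$$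
   Context: A query is $\mathbf{q}=(\mathbf{c},\mathbf{r})$ with $\mathbf{c},\mathbf{r}\in[0,1]^{\bar d}$, ranging over $\mathcal{Q}=\{(\mathbf{c},\mathbf{r})\in[0,1]^d: c_j+r_j\le1\ \forall j\}$. A point $\mathbf{p}$ matches $\mathbf{q}$ if $c_j\le p_j<c_j+r_j$ for all $j$. Fix a measure attribute index $m\in\{1,\dots,\bar d\}$. $f^C_D(\mathbf{q})$ is the number of points of $D$ matching $\mathbf{q}$, and $f^S_D(\mathbf{q})=\sum_{\mathbf{p}\in D\text{ matching }\mathbf{q}}p_m$. $\|g\|_\infty=\sup_{\mathbf{q}\in\mathcal{Q}}|g(\mathbf{q})|$. *)

theory Defs
  imports "HOL-Probability.Probability"
begin

text \<open>Points of [0,1]^dbar are functions nat => real, coordinates 0..dbar-1 (0-based).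
  A query is a pair (c, r).\<close>

datatype agg = Agg_Sum | Agg_Count

definition queries :: "nat \<Rightarrow> ((nat \<Rightarrow> real) \<times> (nat \<Rightarrow> real)) set" where
  "queries dbar = {(c, r). \<forall>j<dbar. 0 \<le> c j \<and> c j \<le> 1 \<and> 0 \<le> r j \<and> r j \<le> 1 \<and> c j + r j \<le> 1}"

definition matches :: "nat \<Rightarrow> (nat \<Rightarrow> real) \<Rightarrow> (nat \<Rightarrow> real) \<times> (nat \<Rightarrow> real) \<Rightarrow> bool" where
  "matches dbar p q \<longleftrightarrow> (\<forall>j<dbar. fst q j \<le> p j \<and> p j < fst q j + snd q j)"

text \<open>Observed query function of a database D of n points (D i for i < n);
  m is the (0-based) measure attribute.\<close>
definition f_obs :: "agg \<Rightarrow> nat \<Rightarrow> nat \<Rightarrow> nat \<Rightarrow> (nat \<Rightarrow> nat \<Rightarrow> real)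
    \<Rightarrow> (nat \<Rightarrow> real) \<times> (nat \<Rightarrow> real) \<Rightarrow> real" where
  "f_obs i dbar m n D q =
     (case i of Agg_Count \<Rightarrow> real (card {k. k < n \<and> matches dbar (D k) q})
              | Agg_Sum \<Rightarrow> (\<Sum>k<n. if matches dbar (D k) q then D k m else 0))"

definition db_measure :: "nat \<Rightarrow> (nat \<Rightarrow> real) measure \<Rightarrow> (nat \<Rightarrow> nat \<Rightarrow> real) measure" where
  "db_measure n chi = PiM {..<n} (\<lambda>_. chi)"

definition f_dist :: "agg \<Rightarrow> nat \<Rightarrow> nat \<Rightarrow> nat \<Rightarrow> (nat \<Rightarrow> real) measure
    \<Rightarrow> (nat \<Rightarrow> real) \<times> (nat \<Rightarrow> real) \<Rightarrow> real" where
  "f_dist i dbar m n chi q = (\<integral>D. f_obs i dbar m n D q \<partial>db_measure n chi)"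

definition sup_norm :: "nat \<Rightarrow> ((nat \<Rightarrow> real) \<times> (nat \<Rightarrow> real) \<Rightarrow> real) \<Rightarrow> real" where
  "sup_norm dbar g = (SUP q\<in>queries dbar. \<bar>g q\<bar>)"

end

theory Submission
  imports Defs
begin

text \<open>
  Instead of symmetrisation, a sample compression argument is used. Write \<open>d\<close> for the number of
  faces of a box. Given the data and a query box, there are a smaller box (the closed hull of the
  matching points) and a larger box (a maximal open one containing no further data points), each
  determined by at most \<open>d\<close> data points and, for the larger one, a set of faces. They match the
  same data as the query, so they bracket both its empirical and its true value. For a fixed set
  \<open>T\<close> of at most \<open>d\<close> indices, the points outside \<open>T\<close> are independent of the box built from \<open>T\<close>,
  and Hoeffding's inequality applies conditionally. A union bound over at most \<open>(2\<^sup>d + 1) (e n / d)\<^sup>d\<close>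
  choices gives the tail \<open>(2\<^sup>d + 1) (e n / d)\<^sup>d exp (- \<epsilon>\<^sup>2 n / 2)\<close>. If the claimed bound is below 1,
  then \<open>n \<epsilon>\<^sup>2 / d\<close> is at least of order \<open>ln (50 / \<epsilon>)\<close>, and part of the exponential absorbs the
  dependence of the prefactor on \<open>n\<close>.
\<close>

section \<open>Regions cut out by a few sample points\<close>

text \<open>\<open>\<phi> f\<close> grows in the outward direction of the face \<open>f\<close>, and
  the threshold of each face is the maximum of \<open>\<phi> f\<close> over \<open>T\<close>. The
  existential form needs no maximum of an empty set: for empty \<open>T\<close> and nonempty
  \<open>\<Phi>\<close> the region is empty.\<close>

definition inner_region where
  "inner_region \<Phi> \<phi> T D p \<longleftrightarrow> (\<forall>f\<in>\<Phi>. \<exists>i\<in>T. \<phi> f p \<le> (\<phi> f (D i) :: real))"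

text \<open>Strict inequalities leave the points that attain a threshold outside, and a face absent
  from \<open>F\<close> imposes no constraint.\<close>

definition outer_region where
  "outer_region F \<phi> T D p \<longleftrightarrow> (\<forall>f\<in>F. \<exists>i\<in>T. \<phi> f p < (\<phi> f (D i) :: real))"

text \<open>One maximiser of \<open>\<phi> f\<close> in \<open>S\<close> per face supplies the hull.
  The hypothesis \<open>down\<close> makes \<open>C f\<close> a lower set of
  \<open>\<phi> f\<close>, so a point below some point of \<open>C f\<close> cannot lie outside
  it.\<close>

lemma inner_region_exists:
  fixes \<phi> :: "'f \<Rightarrow> 'p \<Rightarrow> real"
  assumes "finite \<Phi>" "finite S"
    and down: "\<And>f p x. f \<in> \<Phi> \<Longrightarrow> p \<in> C f \<Longrightarrow> x \<notin> C f \<Longrightarrow> \<phi> f p < \<phi> f x"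
    and S: "\<And>u f. u \<in> S \<Longrightarrow> f \<in> \<Phi> \<Longrightarrow> D u \<in> C f"
  shows "\<exists>T\<subseteq>S. card T \<le> card \<Phi> \<and>
    (\<forall>u\<in>S. inner_region \<Phi> \<phi> T D (D u)) \<and>
    (\<forall>p. inner_region \<Phi> \<phi> T D p \<longrightarrow> (\<forall>f\<in>\<Phi>. p \<in> C f))"
proof (cases "S = {}")
  case True
  then show ?thesis by (auto simp: inner_region_def)
next
  case False
  have "\<exists>i\<in>S. \<forall>u\<in>S. \<phi> f (D u) \<le> \<phi> f (D i)" for f
  proof -
    have "Max ((\<lambda>u. \<phi> f (D u)) ` S) \<in> (\<lambda>u. \<phi> f (D u)) ` S"
      using False assms(2) by (intro Max_in) auto
    then obtain i where "i \<in> S" "Max ((\<lambda>u. \<phi> f (D u)) ` S) = \<phi> f (D i)" by auto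
    then show ?thesis
      using assms(2) by (metis Max_ge finite_imageI imageI)
  qed
  then obtain x where x: "\<And>f. x f \<in> S" "\<And>f u. u \<in> S \<Longrightarrow> \<phi> f (D u) \<le> \<phi> f (D (x f))"
    by metis
  have "p \<in> C f" if p: "inner_region \<Phi> \<phi> (x ` \<Phi>) D p" and f: "f \<in> \<Phi>" for p f
  proof (rule ccontr)
    assume "p \<notin> C f"
    from p f obtain i where "i \<in> S" "\<phi> f p \<le> \<phi> f (D i)"
      using x(1) by (auto simp: inner_region_def)
    then show False
      using down[OF f S[OF \<open>i \<in> S\<close> f] \<open>p \<notin> C f\<close>] by simp
  qed
  moreover have "inner_region \<Phi> \<phi> (x ` \<Phi>) D (D u)" if "u \<in> S" for u
    using x(2)[OF that] by (auto simp: inner_region_def)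
  ultimately show ?thesis
    using x(1) card_image_le[OF assms(1), of x] by (intro exI[of _ "x ` \<Phi>"]) auto
qed

text \<open>
  The faces in \<open>F\<close> are pushed outwards one at a time until each is stopped by a sample point
  that no other face excludes; a face that is never stopped is dropped. The stopping point of a
  face then maximises its functional over \<open>T\<close>, so the unordered set \<open>T\<close> determines the region.
\<close>
lemma outer_region_exists:
  fixes \<phi> :: "'f \<Rightarrow> 'p \<Rightarrow> real"
  assumes "finite \<Phi>" "finite U"
    and down: "\<And>f p x. f \<in> \<Phi> \<Longrightarrow> p \<in> C f \<Longrightarrow> x \<notin> C f \<Longrightarrow> \<phi> f p < \<phi> f x"
    and cover: "\<And>u. u \<in> U \<Longrightarrow> \<exists>f\<in>\<Phi>. D u \<notin> C f"
  shows "\<exists>F\<subseteq>\<Phi>. \<exists>T\<subseteq>U. card T \<le> card \<Phi> \<and>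
    (\<forall>p. (\<forall>f\<in>\<Phi>. p \<in> C f) \<longrightarrow> outer_region F \<phi> T D p) \<and>
    (\<forall>u\<in>U. \<not> outer_region F \<phi> T D (D u))"
proof -
  \<comment> \<open>Faces in \<open>\<Psi>\<close> have been moved already and pass through their
    stopping points \<open>x f\<close>; the others are still in the position
    \<open>C f\<close>.\<close>
  define S where "S = (\<lambda>\<Psi> x f. if f \<in> \<Psi> then {p. \<phi> f p < \<phi> f (D (x f))} else C f)"
  \<comment> \<open>Induction invariant: the faces left in \<open>F\<close> still exclude all of
    \<open>U\<close>, and every moved face among them stops at a point outside \<open>C f\<close>
    that all other faces of \<open>F\<close> admit.\<close>
  have "\<exists>F x. F \<subseteq> \<Phi> \<and> (\<forall>u\<in>U. \<exists>f\<in>F. D u \<notin> S \<Psi> x f) \<and>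
      (\<forall>f\<in>F \<inter> \<Psi>. x f \<in> U \<and> D (x f) \<notin> C f \<and> (\<forall>g\<in>F. g \<noteq> f \<longrightarrow> D (x f) \<in> S \<Psi> x g))"
    if "finite \<Psi>" "\<Psi> \<subseteq> \<Phi>" for \<Psi>
    using that
  proof (induction \<Psi> rule: finite_induct)
    case empty
    then show ?case using cover by (auto simp: S_def intro!: exI[of _ \<Phi>])
  next
    case (insert a \<Psi>)
    then obtain F x where F: "F \<subseteq> \<Phi>" and cov: "\<forall>u\<in>U. \<exists>f\<in>F. D u \<notin> S \<Psi> x f"
      and "\<forall>f\<in>F \<inter> \<Psi>. x f \<in> U \<and> D (x f) \<notin> C f \<and> (\<forall>g\<in>F. g \<noteq> f \<longrightarrow> D (x f) \<in> S \<Psi> x g)"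
      by auto
    then have inv: "\<And>f. f \<in> F \<Longrightarrow> f \<in> \<Psi> \<Longrightarrow> x f \<in> U \<and> D (x f) \<notin> C f"
        "\<And>f g. f \<in> F \<Longrightarrow> f \<in> \<Psi> \<Longrightarrow> g \<in> F \<Longrightarrow> g \<noteq> f \<Longrightarrow> D (x f) \<in> S \<Psi> x g"
      by simp_all
    \<comment> \<open>\<open>V\<close> holds the points that \<open>a\<close> alone could exclude.
      If there are none, \<open>a\<close> is redundant and is dropped; otherwise \<open>a\<close>
      moves out to the first of them that it meets, the minimiser \<open>b\<close> of
      \<open>\<phi> a\<close> on \<open>V\<close>.\<close>
    define V where "V = {u\<in>U. \<forall>g\<in>F - {a}. D u \<in> S \<Psi> x g}"
    show ?case
    proof (cases "V = {}")
      case True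
      have same: "S (insert a \<Psi>) x g = S \<Psi> x g" if "g \<noteq> a" for g
        using that by (auto simp: S_def)
      show ?thesis
        using True F cov inv same
        by (intro exI[of _ "F - {a}"] exI[of _ x]) (auto simp: V_def)
    next
      case False
      have "finite V" using assms(2) by (auto simp: V_def)
      have "Min ((\<lambda>u. \<phi> a (D u)) ` V) \<in> (\<lambda>u. \<phi> a (D u)) ` V"
        using False \<open>finite V\<close> by (intro Min_in) auto
      then obtain b where b: "b \<in> V" and "Min ((\<lambda>u. \<phi> a (D u)) ` V) = \<phi> a (D b)"
        by auto
      then have bmin: "\<phi> a (D b) \<le> \<phi> a (D u)" if "u \<in> V" for u
        using that \<open>finite V\<close> by (metis Min_le finite_imageI imageI)
      define y where "y = x(a := b)"
      have same: "S (insert a \<Psi>) y g = S \<Psi> x g" if "g \<noteq> a" for g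
        using that by (auto simp: S_def y_def)
      have Sa: "S (insert a \<Psi>) y a = {p. \<phi> a p < \<phi> a (D b)}"
        by (auto simp: S_def y_def)
      have Sa': "S \<Psi> x a = C a"
        using insert.hyps by (auto simp: S_def)
      have bU: "b \<in> U" using b by (auto simp: V_def)
      have "a \<in> F" "D b \<notin> C a"
        using cov bU b Sa' by (auto simp: V_def)
      have "\<exists>f\<in>F. D u \<notin> S (insert a \<Psi>) y f" if "u \<in> U" for u
      proof (cases "u \<in> V")
        case True
        then show ?thesis using bmin[OF True] \<open>a \<in> F\<close> Sa by (intro bexI[of _ a]) auto
      next
        case False
        then show ?thesis using that same by (auto simp: V_def)
      qed
      moreover have "y f \<in> U \<and> D (y f) \<notin> C f \<and>
          (\<forall>g\<in>F. g \<noteq> f \<longrightarrow> D (y f) \<in> S (insert a \<Psi>) y g)"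
        if f: "f \<in> F" "f \<in> insert a \<Psi>" for f
      proof (cases "f = a")
        case True
        then show ?thesis
          using bU \<open>D b \<notin> C a\<close> b same by (auto simp: V_def y_def)
      next
        case False
        then have f': "f \<in> F" "f \<in> \<Psi>" and yf: "y f = x f" using f by (auto simp: y_def)
        have "D (x f) \<in> S (insert a \<Psi>) y g" if g: "g \<in> F" "g \<noteq> f" for g
        proof (cases "g = a")
          case True
          \<comment> \<open>The earlier stopping point lies in \<open>C a\<close>, and the moved
            half-space of \<open>a\<close> contains \<open>C a\<close> because \<open>D b\<close> is
            outside \<open>C a\<close>.\<close>
          then have "D (x f) \<in> C a" using inv(2)[OF f' g] Sa' by simp
          then show ?thesis
            using True Sa down[of a "D (x f)" "D b"] \<open>a \<in> F\<close> \<open>D b \<notin> C a\<close> F by auto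
        next
          case False
          then show ?thesis using inv(2)[OF f' g] same by simp
        qed
        then show ?thesis using inv(1)[OF f'] yf by simp
      qed
      ultimately show ?thesis using F by (intro exI[of _ F] exI[of _ y]) auto
    qed
  qed
  from this[OF assms(1) order_refl] obtain F x where F: "F \<subseteq> \<Phi>"
    and cov: "\<forall>u\<in>U. \<exists>f\<in>F. D u \<notin> S \<Phi> x f"
    and "\<forall>f\<in>F \<inter> \<Phi>. x f \<in> U \<and> D (x f) \<notin> C f \<and> (\<forall>g\<in>F. g \<noteq> f \<longrightarrow> D (x f) \<in> S \<Phi> x g)"
    by auto
  then have inv: "\<And>f. f \<in> F \<Longrightarrow> x f \<in> U \<and> D (x f) \<notin> C f"
      "\<And>f g. f \<in> F \<Longrightarrow> g \<in> F \<Longrightarrow> g \<noteq> f \<Longrightarrow> D (x f) \<in> S \<Phi> x g"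
    using F by auto
  have S_eq: "S \<Phi> x f = {p. \<phi> f p < \<phi> f (D (x f))}" if "f \<in> F" for f
    using that F by (auto simp: S_def)
  have top: "\<phi> g (D (x f)) \<le> \<phi> g (D (x g))" if "f \<in> F" "g \<in> F" for f g
    using inv(2)[OF that] S_eq[OF that(2)] by (cases "g = f") auto
  have "card (x ` F) \<le> card \<Phi>"
    using card_image_le[of F x] card_mono[OF assms(1) F] finite_subset[OF F assms(1)] by linarith
  moreover have "outer_region F \<phi> (x ` F) D p" if "\<forall>f\<in>\<Phi>. p \<in> C f" for p
    unfolding outer_region_def
  proof
    fix f assume f: "f \<in> F"
    then have "\<phi> f p < \<phi> f (D (x f))" using that down inv(1) F by blast
    then show "\<exists>i\<in>x ` F. \<phi> f p < \<phi> f (D i)" using f by blast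
  qed
  moreover have "\<not> outer_region F \<phi> (x ` F) D (D u)" if "u \<in> U" for u
  proof -
    from cov that obtain f where f: "f \<in> F" "D u \<notin> S \<Phi> x f" by blast
    then have "\<phi> f (D (x f)) \<le> \<phi> f (D u)"
      using S_eq by simp
    then have "\<not> \<phi> f (D u) < \<phi> f (D i)" if "i \<in> x ` F" for i
      using that top[OF _ f(1)] by fastforce
    then show ?thesis using \<open>f \<in> F\<close> by (auto simp: outer_region_def)
  qed
  ultimately show ?thesis
    using F inv(1) by (intro exI[of _ F] conjI exI[of _ "x ` F"]) auto
qed

section \<open>Counting small index sets\<close>

text \<open>With \<open>y = d / n\<close> at most 1, replacing \<open>y ^ d\<close> by
  \<open>y ^ i\<close> for \<open>i \<le> d\<close> can only enlarge the sum of binomial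
  coefficients. Extended to all \<open>i \<le> n\<close> it becomes \<open>(1 + y) ^ n\<close>,
  which is at most \<open>exp 1 ^ d\<close>.\<close>

lemma card_subsets_card_le_bound:
  assumes "finite A" "1 \<le> d" "d \<le> card A"
  shows "real (card {T. T \<subseteq> A \<and> card T \<le> d}) \<le> (exp 1 * real (card A) / real d) ^ d"
proof -
  define n where "n = card A"
  have n: "n > 0" "d \<le> n" "d > 0" using assms by (auto simp: n_def)
  define y where "y = real d / real n"
  have y: "0 < y" "y \<le> 1" using n by (auto simp: y_def field_simps)
  have "{T. T \<subseteq> A \<and> card T \<le> d} = (\<Union>i\<in>{..d}. {T. T \<subseteq> A \<and> card T = i})" by auto
  then have "card {T. T \<subseteq> A \<and> card T \<le> d} \<le> (\<Sum>i\<le>d. card {T. T \<subseteq> A \<and> card T = i})"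
    using card_UN_le[of "{..d}"] by simp
  then have "real (card {T. T \<subseteq> A \<and> card T \<le> d}) \<le> (\<Sum>i\<le>d. real (n choose i))"
    using assms(1) by (simp add: n_subsets n_def flip: of_nat_sum)
  then have "real (card {T. T \<subseteq> A \<and> card T \<le> d}) * y ^ d \<le> (\<Sum>i\<le>d. real (n choose i)) * y ^ d"
    using y by (intro mult_right_mono) auto
  also have "\<dots> \<le> (\<Sum>i\<le>d. real (n choose i) * y ^ i)"
    unfolding sum_distrib_right using y
    by (intro sum_mono mult_left_mono power_decreasing) auto
  also have "\<dots> \<le> (\<Sum>i\<le>n. real (n choose i) * y ^ i)"
    using y n by (intro sum_mono2) auto
  also have "\<dots> = (1 + y) ^ n"
    using binomial_ring[of y 1 n] by (simp add: add.commute)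
  also have "\<dots> \<le> exp y ^ n"
    using y exp_ge_add_one_self[of y] by (intro power_mono) auto
  also have "\<dots> = exp 1 ^ d"
    using n by (simp add: y_def flip: exp_of_nat_mult)
  finally have "real (card {T. T \<subseteq> A \<and> card T \<le> d}) \<le> exp 1 ^ d / y ^ d"
    using y by (simp add: field_simps)
  also have "\<dots> = (exp 1 * real n / real d) ^ d"
    using n by (simp add: y_def power_divide power_mult_distrib field_simps)
  finally show ?thesis by (simp add: n_def)
qed

section \<open>Hoeffding's inequality with a data-dependent function\<close>

lemma indep_vars_PiM_coordinates:
  assumes "prob_space M" "J \<noteq> {}"
  shows "prob_space.indep_vars (PiM J (\<lambda>_. M)) (\<lambda>_. M) (\<lambda>i \<omega>. \<omega> i) J"
proof -
  interpret M: prob_space M by fact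
  interpret product_prob_space "\<lambda>_. M" J ..
  have "distr (PiM J (\<lambda>_. M)) (PiM J (\<lambda>_. M)) (\<lambda>x. \<lambda>i\<in>J. x i) = PiM J (\<lambda>_. M)"
    by (subst distr_id2[symmetric]) (auto intro!: distr_cong simp: space_PiM PiE_def extensional_restrict)
  also have "\<dots> = PiM J (\<lambda>i. distr (PiM J (\<lambda>_. M)) M (\<lambda>\<omega>. \<omega> i))"
    by (intro PiM_cong refl) (simp add: PiM_component)
  finally show ?thesis
    using assms(2) by (subst P.indep_vars_iff_distr_eq_PiM') auto
qed

text \<open>The later sums run over complements of small sets of varying size. Bounding the number
  of summands by a common \<open>N\<close> gives all of them the same tail value in the union
  bound.\<close>

lemma Hoeffding_iid_sum:
  fixes f :: "'a \<Rightarrow> real"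
  assumes M: "prob_space M" and f [measurable]: "f \<in> borel_measurable M"
    and range: "\<And>x. f x \<in> {a..a + 1}"
    and J: "finite J" "card J \<le> N" "0 < N" and t: "0 < t"
  shows "measure (PiM J (\<lambda>_. M))
      {\<omega>\<in>space (PiM J (\<lambda>_. M)). (\<Sum>i\<in>J. f (\<omega> i)) \<ge> card J * (\<integral>x. f x \<partial>M) + t}
    \<le> exp (- 2 * t\<^sup>2 / N)"
proof (cases "J = {}")
  case True
  then show ?thesis using t by (simp add: not_le)
next
  case False
  interpret M: prob_space M by fact
  interpret product_prob_space "\<lambda>_. M" J ..
  have E: "P.expectation (\<lambda>\<omega>. f (\<omega> i)) = (\<integral>x. f x \<partial>M)" if "i \<in> J" for i
  proof -
    have "(\<integral>x. f x \<partial>M) = (\<integral>x. f x \<partial>distr (PiM J (\<lambda>_. M)) M (\<lambda>\<omega>. \<omega> i))"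
      using that by (simp add: PiM_component)
    also have "\<dots> = P.expectation (\<lambda>\<omega>. f (\<omega> i))"
      using that by (intro integral_distr) auto
    finally show ?thesis ..
  qed
  have ind: "P.indep_vars (\<lambda>_. borel) (\<lambda>i \<omega>. f (\<omega> i)) J"
    using indep_vars_PiM_coordinates[OF M False] by (rule P.indep_vars_compose2) auto
  interpret H: Hoeffding_ineq "PiM J (\<lambda>_. M)" J "\<lambda>i \<omega>. f (\<omega> i)" "\<lambda>_. a" "\<lambda>_. a + 1"
    "\<Sum>i\<in>J. P.expectation (\<lambda>\<omega>. f (\<omega> i))"
    by unfold_locales (use J ind range in auto)
  have c: "0 < card J" using False J by (simp add: card_gt_0_iff)
  have "(\<Sum>i\<in>J. P.expectation (\<lambda>\<omega>. f (\<omega> i))) = card J * (\<integral>x. f x \<partial>M)"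
    using E by simp
  then have "P.prob {\<omega>\<in>space (PiM J (\<lambda>_. M)). (\<Sum>i\<in>J. f (\<omega> i)) \<ge> card J * (\<integral>x. f x \<partial>M) + t}
      \<le> exp (- 2 * t\<^sup>2 / card J)"
    using H.Hoeffding_ineq_ge[of t] t c by simp
  also have "\<dots> \<le> exp (- 2 * t\<^sup>2 / N)"
    using c J by (simp add: divide_left_mono)
  finally show ?thesis .
qed

text \<open>Once the coordinates in \<open>T\<close> are fixed, so is the function \<open>h\<close>,
  while the coordinates in \<open>I - T\<close> keep their product law. The i.i.d. bound holds for
  each value on \<open>T\<close> and, by Fubini's theorem, survives integration over these
  values.\<close>

lemma Hoeffding_sample_dependent:
  fixes h :: "('i \<Rightarrow> 'a) \<Rightarrow> 'a \<Rightarrow> real"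
  assumes M: "prob_space M" and I: "finite I" "T \<subseteq> I" "card I \<le> N" "0 < N"
    and h: "case_prod h \<in> borel_measurable (PiM T (\<lambda>_. M) \<Otimes>\<^sub>M M)"
    and range: "\<And>D x. h D x \<in> {a..a + 1}" and t: "0 < t"
  defines "A \<equiv> {D\<in>space (PiM I (\<lambda>_. M)). (\<Sum>i\<in>I - T. h (restrict D T) (D i)) \<ge>
      card (I - T) * (\<integral>x. h (restrict D T) x \<partial>M) + t}"
  shows "A \<in> sets (PiM I (\<lambda>_. M))"
    and "measure (PiM I (\<lambda>_. M)) A \<le> exp (- 2 * t\<^sup>2 / N)"
proof -
  interpret M: prob_space M by fact
  interpret product_prob_space "\<lambda>_. M" I ..
  interpret T: prob_space "PiM T (\<lambda>_. M)" by (intro prob_space_PiM M)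
  interpret J: prob_space "PiM (I - T) (\<lambda>_. M)" by (intro prob_space_PiM M)
  have res [measurable]: "(\<lambda>D. restrict D T) \<in> measurable (PiM I (\<lambda>_. M)) (PiM T (\<lambda>_. M))"
    using I by (intro measurable_restrict_subset)
  have [measurable]: "(\<lambda>D. h (restrict D T) (D i)) \<in> borel_measurable (PiM I (\<lambda>_. M))"
    if "i \<in> I - T" for i
  proof -
    have "(\<lambda>D. (restrict D T, D i)) \<in> measurable (PiM I (\<lambda>_. M)) (PiM T (\<lambda>_. M) \<Otimes>\<^sub>M M)"
      using that by (intro measurable_Pair res measurable_component_singleton) auto
    from measurable_compose[OF this h] show ?thesis by simp
  qed
  have "(\<lambda>D. \<integral>x. h D x \<partial>M) \<in> borel_measurable (PiM T (\<lambda>_. M))"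
    using h by (rule M.borel_measurable_lebesgue_integral)
  then have [measurable]: "(\<lambda>D. \<integral>x. h (restrict D T) x \<partial>M) \<in> borel_measurable (PiM I (\<lambda>_. M))"
    by (rule measurable_compose[OF res])
  show A: "A \<in> sets (PiM I (\<lambda>_. M))"
    unfolding A_def by measurable
  have split: "T \<inter> (I - T) = {}" "finite T" "finite (I - T)" "T \<union> (I - T) = I"
    using I finite_subset by auto
  have "emeasure (PiM I (\<lambda>_. M)) A =
      (\<integral>\<^sup>+x. emeasure (PiM (I - T) (\<lambda>_. M))
        ((\<lambda>y. merge T (I - T) (x, y)) -` A \<inter> space (PiM (I - T) (\<lambda>_. M))) \<partial>PiM T (\<lambda>_. M))"
    using emeasure_fold_integral[OF split(1-3), of A] A split(4) by simp
  also have "\<dots> \<le> (\<integral>\<^sup>+x. ennreal (exp (- 2 * t\<^sup>2 / N)) \<partial>PiM T (\<lambda>_. M))"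
  proof (intro nn_integral_mono)
    fix x assume x: "x \<in> space (PiM T (\<lambda>_. M))"
    have hx: "h x \<in> borel_measurable M"
      using measurable_Pair2[OF h x] by simp
    have eq: "(\<Sum>i\<in>I - T. h (restrict (merge T (I - T) (x, y)) T) (merge T (I - T) (x, y) i)) =
        (\<Sum>i\<in>I - T. h x (y i))"
      "restrict (merge T (I - T) (x, y)) T = x" for y
    proof -
      show r: "restrict (merge T (I - T) (x, y)) T = x"
        using x by (auto simp: space_PiM PiE_def extensional_restrict)
      show "(\<Sum>i\<in>I - T. h (restrict (merge T (I - T) (x, y)) T) (merge T (I - T) (x, y) i)) =
        (\<Sum>i\<in>I - T. h x (y i))"
        unfolding r by (intro sum.cong) (auto simp: merge_def)
    qed
    have sp: "merge T (I - T) (x, y) \<in> space (PiM I (\<lambda>_. M))"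
      if "y \<in> space (PiM (I - T) (\<lambda>_. M))" for y
      using that x split(4) I(2) by (auto simp: space_PiM PiE_def Pi_iff merge_def extensional_def)
    have "(\<lambda>y. merge T (I - T) (x, y)) -` A \<inter> space (PiM (I - T) (\<lambda>_. M)) =
      {y\<in>space (PiM (I - T) (\<lambda>_. M)). (\<Sum>i\<in>I - T. h x (y i)) \<ge> card (I - T) * (\<integral>p. h x p \<partial>M) + t}"
      unfolding A_def using sp by (auto simp: eq)
    also have "emeasure (PiM (I - T) (\<lambda>_. M)) \<dots> \<le> ennreal (exp (- 2 * t\<^sup>2 / N))"
      unfolding J.emeasure_eq_measure
      using I card_mono[OF I(1), of "I - T"]
      by (intro ennreal_leI Hoeffding_iid_sum[OF M hx range] t) auto
    finally show "emeasure (PiM (I - T) (\<lambda>_. M))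
        ((\<lambda>y. merge T (I - T) (x, y)) -` A \<inter> space (PiM (I - T) (\<lambda>_. M)))
      \<le> ennreal (exp (- 2 * t\<^sup>2 / N))" .
  qed
  also have "\<dots> = ennreal (exp (- 2 * t\<^sup>2 / N))"
    by (simp add: T.emeasure_space_1)
  finally show "measure (PiM I (\<lambda>_. M)) A \<le> exp (- 2 * t\<^sup>2 / N)"
    unfolding P.emeasure_eq_measure by (simp add: ennreal_le_iff)
qed

section \<open>Uniform deviation for intersections of half-spaces\<close>

text \<open>One exceptional set has to serve all families \<open>C\<close> at once. The regions that
  bracket their intersections come from a finite list: one bad event per \<open>T\<close> for the
  inner regions and one per pair \<open>(F, T)\<close> for the outer ones, whence the factor
  \<open>2 ^ card \<Phi> + 1\<close>.\<close>

lemma uniform_deviation_down_sets: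
  fixes \<phi> :: "'f \<Rightarrow> 'p \<Rightarrow> real" and g :: "'p \<Rightarrow> real" and \<epsilon> :: real
  assumes M: "prob_space M" and \<Phi>: "finite \<Phi>" "\<Phi> \<noteq> {}"
    and \<phi>: "\<And>f. f \<in> \<Phi> \<Longrightarrow> \<phi> f \<in> borel_measurable M"
    and g: "g \<in> borel_measurable M" "\<And>x. g x \<in> {0..1}"
    and n: "card \<Phi> \<le> n" "2 * real (card \<Phi>) \<le> n * \<epsilon>" and \<epsilon>: "0 < \<epsilon>"
  shows "\<exists>A\<in>sets (PiM {..<n} (\<lambda>_. M)).
    measure (PiM {..<n} (\<lambda>_. M)) A \<le>
      (2 ^ card \<Phi> + 1) * (exp 1 * n / card \<Phi>) ^ card \<Phi> * exp (- (\<epsilon>\<^sup>2 * n) / 2) \<and>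
    (\<forall>D\<in>space (PiM {..<n} (\<lambda>_. M)) - A. \<forall>C.
      (\<forall>f\<in>\<Phi>. \<forall>p\<in>C f. \<forall>x. x \<notin> C f \<longrightarrow> \<phi> f p < \<phi> f x) \<longrightarrow>
      {x\<in>space M. \<forall>f\<in>\<Phi>. x \<in> C f} \<in> sets M \<longrightarrow>
      \<bar>(\<Sum>i<n. if \<forall>f\<in>\<Phi>. D i \<in> C f then g (D i) else 0) -
        n * (\<integral>x. (if \<forall>f\<in>\<Phi>. x \<in> C f then g x else 0) \<partial>M)\<bar> \<le> n * \<epsilon>)"
proof -
  interpret M: prob_space M by fact
  define I where "I = {..<n}"
  interpret product_prob_space "\<lambda>_. M" I ..
  define d where "d = card \<Phi>"
  have d: "1 \<le> d" "d \<le> n" using \<Phi> n by (auto simp: d_def Suc_le_eq card_gt_0_iff)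
  then have n0: "0 < n" by simp
  have I: "finite I" "card I = n" by (auto simp: I_def)
  define TT where "TT = {T. T \<subseteq> I \<and> card T \<le> d}"
  \<comment> \<open>Half of the deviation \<open>n * \<epsilon>\<close> is spent on Hoeffding's
    inequality; the other half pays for the at most \<open>d\<close> points of \<open>T\<close>, to
    which it does not apply.\<close>
  define t where "t = n * \<epsilon> / 2"
  have t: "0 < t" using n0 \<epsilon> by (simp add: t_def)
  have bnd: "exp (- 2 * t\<^sup>2 / n) = exp (- (\<epsilon>\<^sup>2 * n) / 2)"
    using n0 by (simp add: t_def power2_eq_square)
  define hi where "hi = (\<lambda>(T :: nat set) (D :: nat \<Rightarrow> 'p) x. if inner_region \<Phi> \<phi> T D x then g x else 0)"
  \<comment> \<open>The sign turns the upper tail bound into a lower tail bound for the outer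
    region; the range is again an interval of length 1.\<close>
  define ho where "ho = (\<lambda>F (T :: nat set) (D :: nat \<Rightarrow> 'p) x. - (if outer_region F \<phi> T D x then g x else 0))"
  have \<phi>_pair: "(\<lambda>z. \<phi> f (snd z)) \<in> borel_measurable (PiM T (\<lambda>_. M) \<Otimes>\<^sub>M M)"
      "i \<in> T \<Longrightarrow> (\<lambda>z. \<phi> f (fst z i)) \<in> borel_measurable (PiM T (\<lambda>_. M) \<Otimes>\<^sub>M M)"
    if "f \<in> \<Phi>" for f i T
    using \<phi>[OF that] by measurable
  have g_pair [measurable]: "(\<lambda>z. g (snd z)) \<in> borel_measurable (PiM T (\<lambda>_. M) \<Otimes>\<^sub>M M)" for T
    using g(1) by measurable
  have hi_meas: "case_prod (hi T) \<in> borel_measurable (PiM T (\<lambda>_. M) \<Otimes>\<^sub>M M)"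
    if "T \<in> TT" for T
  proof -
    have "finite T" using that I finite_subset by (auto simp: TT_def)
    have "Measurable.pred (PiM T (\<lambda>_. M) \<Otimes>\<^sub>M M) (\<lambda>z. inner_region \<Phi> \<phi> T (fst z) (snd z))"
      unfolding inner_region_def not_less[symmetric]
      by (intro pred_intros_finite(3,4) pred_intros_logic(2) \<Phi> \<open>finite T\<close>
          borel_measurable_pred_less \<phi>_pair)
    then show ?thesis
      unfolding hi_def case_prod_beta' by measurable
  qed
  have ho_meas: "case_prod (ho F T) \<in> borel_measurable (PiM T (\<lambda>_. M) \<Otimes>\<^sub>M M)"
    if "F \<subseteq> \<Phi>" "T \<in> TT" for F T
  proof -
    have "finite T" using that I finite_subset by (auto simp: TT_def)
    have "finite F" using that \<Phi> finite_subset by auto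
    have "Measurable.pred (PiM T (\<lambda>_. M) \<Otimes>\<^sub>M M) (\<lambda>z. outer_region F \<phi> T (fst z) (snd z))"
      unfolding outer_region_def
      using that
      by (intro pred_intros_finite(3,4) \<open>finite F\<close> \<open>finite T\<close> borel_measurable_pred_less \<phi>_pair) auto
    then show ?thesis
      unfolding ho_def case_prod_beta' by measurable
  qed
  define bad where "bad = (\<lambda>T h. {D\<in>space (PiM I (\<lambda>_. M)). (\<Sum>i\<in>I - T. h (restrict D T) (D i)) \<ge>
      card (I - T) * (\<integral>x. h (restrict D T) x \<partial>M) + t})"
  have TT_I: "T \<subseteq> I" if "T \<in> TT" for T using that by (auto simp: TT_def)
  have hi_bad: "bad T (hi T) \<in> sets (PiM I (\<lambda>_. M))"
      "P.prob (bad T (hi T)) \<le> exp (- (\<epsilon>\<^sup>2 * n) / 2)" if "T \<in> TT" for T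
  proof -
    have "hi T D x \<in> {0..0 + 1}" for D x using g(2)[of x] by (auto simp: hi_def)
    note H = Hoeffding_sample_dependent[OF M I(1) TT_I[OF that] eq_refl[OF I(2)] n0 hi_meas[OF that] this t]
    show "bad T (hi T) \<in> sets (PiM I (\<lambda>_. M))" using H(1) unfolding bad_def .
    show "P.prob (bad T (hi T)) \<le> exp (- (\<epsilon>\<^sup>2 * n) / 2)" using H(2) unfolding bad_def bnd .
  qed
  have ho_bad: "bad T (ho F T) \<in> sets (PiM I (\<lambda>_. M))"
      "P.prob (bad T (ho F T)) \<le> exp (- (\<epsilon>\<^sup>2 * n) / 2)" if "F \<subseteq> \<Phi>" "T \<in> TT" for F T
  proof -
    have "ho F T D x \<in> {-1..-1 + 1}" for D x using g(2)[of x] by (auto simp: ho_def)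
    note H = Hoeffding_sample_dependent[OF M I(1) TT_I[OF that(2)] eq_refl[OF I(2)] n0 ho_meas[OF that] this t]
    show "bad T (ho F T) \<in> sets (PiM I (\<lambda>_. M))" using H(1) unfolding bad_def .
    show "P.prob (bad T (ho F T)) \<le> exp (- (\<epsilon>\<^sup>2 * n) / 2)" using H(2) unfolding bad_def bnd .
  qed
  have fin: "finite TT" "finite (Pow \<Phi>)" using I \<Phi> by (auto simp: TT_def)
  define Ai where "Ai = (\<Union>T\<in>TT. bad T (hi T))"
  define Ao where "Ao = (\<Union>(F, T)\<in>Pow \<Phi> \<times> TT. bad T (ho F T))"
  have Ai: "Ai \<in> sets (PiM I (\<lambda>_. M))" and Ao: "Ao \<in> sets (PiM I (\<lambda>_. M))"
    using fin hi_bad(1) ho_bad(1) by (auto simp: Ai_def Ao_def intro!: sets.finite_UN)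
  define e where "e = exp (- (\<epsilon>\<^sup>2 * n) / 2)"
  have "P.prob Ai \<le> (\<Sum>T\<in>TT. P.prob (bad T (hi T)))"
    unfolding Ai_def using fin hi_bad(1) by (intro P.finite_measure_subadditive_finite) auto
  also have "\<dots> \<le> (\<Sum>T\<in>TT. e)"
    using hi_bad(2) by (intro sum_mono) (auto simp: e_def)
  finally have Ai_le: "P.prob Ai \<le> card TT * e" by simp
  have "P.prob Ao \<le> (\<Sum>(F, T)\<in>Pow \<Phi> \<times> TT. P.prob (bad T (ho F T)))"
    unfolding Ao_def case_prod_beta' using fin ho_bad(1)
    by (intro P.finite_measure_subadditive_finite) auto
  also have "\<dots> \<le> (\<Sum>(F, T)\<in>Pow \<Phi> \<times> TT. e)"
    using ho_bad(2) by (intro sum_mono) (auto simp: e_def)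
  also have "\<dots> = 2 ^ d * (card TT * e)"
    using \<Phi> fin by (simp add: card_Pow card_cartesian_product d_def)
  finally have "P.prob Ao \<le> 2 ^ d * (card TT * e)" .
  with Ai_le have "P.prob (Ai \<union> Ao) \<le> (2 ^ d + 1) * real (card TT) * e"
    using measure_Un_le[OF Ai Ao] by (simp add: algebra_simps)
  also have "\<dots> \<le> (2 ^ d + 1) * (exp 1 * n / d) ^ d * e"
    using card_subsets_card_le_bound[OF I(1) d(1)] d I(2)
    by (intro mult_right_mono mult_left_mono) (auto simp: TT_def e_def)
  finally have prob: "P.prob (Ai \<union> Ao) \<le> (2 ^ d + 1) * (exp 1 * n / d) ^ d * e" .
  have "\<bar>(\<Sum>i\<in>I. if \<forall>f\<in>\<Phi>. D i \<in> C f then g (D i) else 0) -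
        n * (\<integral>x. (if \<forall>f\<in>\<Phi>. x \<in> C f then g x else 0) \<partial>M)\<bar> \<le> n * \<epsilon>"
    if D: "D \<in> space (PiM I (\<lambda>_. M))" "D \<notin> Ai \<union> Ao"
      and down: "\<forall>f\<in>\<Phi>. \<forall>p\<in>C f. \<forall>x. x \<notin> C f \<longrightarrow> \<phi> f p < \<phi> f x"
      and C: "{x\<in>space M. \<forall>f\<in>\<Phi>. x \<in> C f} \<in> sets M" for D C
  proof -
    define gq where "gq = (\<lambda>x. if \<forall>f\<in>\<Phi>. x \<in> C f then g x else 0)"
    define \<mu> where "\<mu> = (\<integral>x. gq x \<partial>M)"
    have gq01: "0 \<le> gq x" "gq x \<le> 1" "gq x \<le> g x" for x using g(2)[of x] by (auto simp: gq_def)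
    have g0: "0 \<le> g x" for x using g(2)[of x] by simp
    have "gq \<in> borel_measurable M"
      unfolding gq_def using C g(1) by (intro measurable_If) auto
    then have gq_int: "integrable M gq"
      using gq01 by (intro M.integrable_const_bound[of _ 1]) auto
    have \<mu>: "0 \<le> \<mu>" "\<mu> \<le> 1"
      using gq01 M.integral_le_const[OF gq_int, of 1] by (auto simp: \<mu>_def)
    have rs: "restrict D T \<in> space (PiM T (\<lambda>_. M))" if "T \<in> TT" for T
      using D(1) that by (auto simp: TT_def space_PiM PiE_def Pi_iff)
    \<comment> \<open>Both regions read the sample only on \<open>T\<close>, as the conditional
      bound requires.\<close>
    have reg: "inner_region \<Psi> \<phi> T (restrict D T) x = inner_region \<Psi> \<phi> T D x"
      "outer_region \<Psi> \<phi> T (restrict D T) x = outer_region \<Psi> \<phi> T D x" for \<Psi> T x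
      by (auto simp: inner_region_def outer_region_def)
    have card_diff: "real n - d \<le> card (I - T)" "card (I - T) \<le> n" if "T \<in> TT" for T
    proof -
      from that have T: "T \<subseteq> I" "card T \<le> d" by (auto simp: TT_def)
      have "card (I - T) = n - card T"
        using T I by (simp add: card_Diff_subset finite_subset)
      then show "real n - d \<le> card (I - T)" "card (I - T) \<le> n" using T d by auto
    qed
    \<comment> \<open>The inner region contains all sample points of the intersection and lies
      within it, so passing to it does not lower the empirical sum and does not raise the mean. The
      points of \<open>T\<close> add at most \<open>card T\<close> to the sum.\<close>
    have upper: "(\<Sum>i\<in>I. gq (D i)) - n * \<mu> \<le> n * \<epsilon>"
    proof -
      have "\<exists>T\<subseteq>{i\<in>I. \<forall>f\<in>\<Phi>. D i \<in> C f}. card T \<le> card \<Phi> \<and>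
          (\<forall>i\<in>{i\<in>I. \<forall>f\<in>\<Phi>. D i \<in> C f}. inner_region \<Phi> \<phi> T D (D i)) \<and>
          (\<forall>p. inner_region \<Phi> \<phi> T D p \<longrightarrow> (\<forall>f\<in>\<Phi>. p \<in> C f))"
        using \<Phi>(1) I(1) down by (intro inner_region_exists) auto
      then obtain T where T: "T \<subseteq> {i\<in>I. \<forall>f\<in>\<Phi>. D i \<in> C f}" "card T \<le> d"
        "\<forall>i\<in>{i\<in>I. \<forall>f\<in>\<Phi>. D i \<in> C f}. inner_region \<Phi> \<phi> T D (D i)"
        "\<forall>p. inner_region \<Phi> \<phi> T D p \<longrightarrow> (\<forall>f\<in>\<Phi>. p \<in> C f)"
        unfolding d_def by blast
      have TT: "T \<in> TT" using T by (auto simp: TT_def)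
      define h where "h = hi T (restrict D T)"
      have h: "h x = (if inner_region \<Phi> \<phi> T D x then g x else 0)" for x
        by (simp add: h_def hi_def reg)
      have h01: "0 \<le> h x" "h x \<le> 1" for x using g(2)[of x] by (auto simp: h)
      have "h \<in> borel_measurable M"
        using measurable_Pair2[OF hi_meas[OF TT] rs[OF TT]] by (simp add: h_def)
      then have h_int: "integrable M h"
        using h01 by (intro M.integrable_const_bound[of _ 1]) auto
      have "(\<integral>x. h x \<partial>M) \<le> \<mu>"
        unfolding \<mu>_def using T(4) g(2) by (intro integral_mono h_int gq_int) (auto simp: h gq_def)
      then have "card (I - T) * (\<integral>x. h x \<partial>M) \<le> n * \<mu>"
        using card_diff[OF TT] \<mu> h01 by (intro mult_mono) auto
      moreover have "(\<Sum>i\<in>I - T. h (D i)) < card (I - T) * (\<integral>x. h x \<partial>M) + t"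
        using D TT by (auto simp: Ai_def bad_def h_def not_le)
      moreover have "(\<Sum>i\<in>I. gq (D i)) \<le> (\<Sum>i\<in>I. h (D i))"
        using T(3) g0 by (intro sum_mono) (auto simp: gq_def h)
      moreover have "(\<Sum>i\<in>I. h (D i)) = (\<Sum>i\<in>I - T. h (D i)) + (\<Sum>i\<in>T. h (D i))"
        using T(1) I by (intro sum.subset_diff) auto
      moreover have "(\<Sum>i\<in>T. h (D i)) \<le> card T"
        using sum_bounded_above[of T "\<lambda>i. h (D i)" 1] h01 by simp
      ultimately show ?thesis
        using T(2) n(2) by (simp add: t_def d_def)
    qed
    \<comment> \<open>The outer region contains the intersection but no further sample points, so it
      does not lower the mean and does not raise the empirical sum.\<close>
    have lower: "n * \<mu> - (\<Sum>i\<in>I. gq (D i)) \<le> n * \<epsilon>"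
    proof -
      have "\<exists>F\<subseteq>\<Phi>. \<exists>T\<subseteq>{i\<in>I. \<not> (\<forall>f\<in>\<Phi>. D i \<in> C f)}. card T \<le> card \<Phi> \<and>
          (\<forall>p. (\<forall>f\<in>\<Phi>. p \<in> C f) \<longrightarrow> outer_region F \<phi> T D p) \<and>
          (\<forall>i\<in>{i\<in>I. \<not> (\<forall>f\<in>\<Phi>. D i \<in> C f)}. \<not> outer_region F \<phi> T D (D i))"
        using \<Phi>(1) I(1) down by (intro outer_region_exists) auto
      then obtain F T where FT: "F \<subseteq> \<Phi>" "T \<subseteq> {i\<in>I. \<not> (\<forall>f\<in>\<Phi>. D i \<in> C f)}" "card T \<le> d"
        "\<forall>p. (\<forall>f\<in>\<Phi>. p \<in> C f) \<longrightarrow> outer_region F \<phi> T D p"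
        "\<forall>i\<in>{i\<in>I. \<not> (\<forall>f\<in>\<Phi>. D i \<in> C f)}. \<not> outer_region F \<phi> T D (D i)"
        unfolding d_def by blast
      have TT: "T \<in> TT" using FT by (auto simp: TT_def)
      define h where "h = (\<lambda>x. - ho F T (restrict D T) x)"
      have h: "h x = (if outer_region F \<phi> T D x then g x else 0)" for x
        by (simp add: h_def ho_def reg)
      have h01: "0 \<le> h x" "h x \<le> 1" for x using g(2)[of x] by (auto simp: h)
      have "h \<in> borel_measurable M"
        using measurable_Pair2[OF ho_meas[OF FT(1) TT] rs[OF TT]] by (simp add: h_def)
      then have h_int: "integrable M h"
        using h01 by (intro M.integrable_const_bound[of _ 1]) auto
      have "\<mu> \<le> (\<integral>x. h x \<partial>M)"
        unfolding \<mu>_def using FT(4) g(2) by (intro integral_mono h_int gq_int) (auto simp: h gq_def)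
      \<comment> \<open>Here \<open>T\<close> is paid for on the side of the mean: at least
        \<open>n - d\<close> indices remain, and the missing share \<open>d * \<mu>\<close> is at
        most \<open>d\<close>.\<close>
      then have "(real n - d) * \<mu> \<le> card (I - T) * (\<integral>x. h x \<partial>M)"
        using card_diff[OF TT] \<mu> h01 by (intro mult_mono) auto
      moreover have "d * \<mu> \<le> d" using \<mu> mult_left_le[of \<mu> "real d"] by simp
      moreover have "card (I - T) * (\<integral>x. h x \<partial>M) - t < (\<Sum>i\<in>I - T. h (D i))"
      proof -
        have "D \<notin> bad T (ho F T)" using D FT(1) TT by (auto simp: Ao_def)
        then have "(\<Sum>i\<in>I - T. - h (D i)) < card (I - T) * (\<integral>x. - h x \<partial>M) + t"
          using D(1) by (simp add: bad_def h_def not_le)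
        then show ?thesis by (simp add: sum_negf)
      qed
      moreover have "(\<Sum>i\<in>I - T. h (D i)) \<le> (\<Sum>i\<in>I - T. gq (D i))"
        using FT(5) g0 by (intro sum_mono) (auto simp: gq_def h)
      moreover have "(\<Sum>i\<in>I - T. gq (D i)) \<le> (\<Sum>i\<in>I. gq (D i))"
        using I gq01 by (intro sum_mono2) auto
      ultimately show ?thesis
        using n(2) by (simp add: t_def d_def algebra_simps)
    qed
    from upper lower show ?thesis
      by (simp add: gq_def \<mu>_def abs_le_iff)
  qed
  then show ?thesis
    using Ai Ao prob unfolding I_def d_def e_def
    by (intro bexI[of _ "Ai \<union> Ao"] conjI) (auto simp: I_def)
qed

section \<open>Absorbing the counting factor into the exponential\<close>

text \<open>A probability bound of at least 1 is trivial, so only \<open>R < 1\<close> matters. This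
  forces \<open>n\<close> to be large compared with \<open>d / \<epsilon>\<^sup>2\<close>, which
  yields the size conditions of the uniform bound and lets part of the exponent absorb the factor
  \<open>(n / d) ^ d\<close>.\<close>

lemma tail_bound_absorbs_counting:
  fixes \<epsilon> :: real and d n :: nat
  assumes d: "1 \<le> d" and \<epsilon>: "0 < \<epsilon>" "\<epsilon> < 1"
  defines "R \<equiv> 50 ^ (d + 1) * real d * \<epsilon> powi (- int d) * exp (- (\<epsilon>\<^sup>2 * real n) / 50)"
  assumes R: "R < 1"
  shows "d \<le> n" "2 * real d \<le> n * \<epsilon>"
    "(2 ^ d + 1) * (exp 1 * n / d) ^ d * exp (- (\<epsilon>\<^sup>2 * n) / 2) \<le> R"
proof -
  define y where "y = \<epsilon>\<^sup>2 * n / d"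
  have dy: "\<epsilon>\<^sup>2 * n = d * y" and n_eq: "n / d = y / \<epsilon>\<^sup>2"
    using d \<epsilon> by (simp_all add: y_def)
  have R_eq: "R = 50 * real d * ((50 / \<epsilon>) ^ d * exp (- (d * y) / 50))"
  proof -
    have "\<epsilon> powi (- int d) = 1 / \<epsilon> ^ d" by (simp add: power_int_minus divide_inverse)
    then show ?thesis unfolding R_def dy by (simp add: power_divide)
  qed
  have "(50 / \<epsilon>) ^ d * exp (- (d * y) / 50) \<le> R"
    unfolding R_eq using d \<epsilon>
      mult_right_mono[of 1 "50 * real d" "(50 / \<epsilon>) ^ d * exp (- (d * y) / 50)"] by simp
  with R have "(50 / \<epsilon>) ^ d * exp (- (d * y) / 50) < 1" by simp
  then have "(50 / \<epsilon>) ^ d < exp (d * (y / 50))"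
  proof -
    have "x < exp z" if "x * exp (- z) < 1" for x z :: real
      using that by (simp add: exp_minus field_simps)
    from this[of "(50 / \<epsilon>) ^ d" "d * (y / 50)"] show ?thesis
      using \<open>(50 / \<epsilon>) ^ d * exp (- (d * y) / 50) < 1\<close> by simp
  qed
  also have "\<dots> = exp (y / 50) ^ d"
    by (rule exp_of_nat_mult)
  finally have base: "50 / \<epsilon> < exp (y / 50)"
    by (rule power_less_imp_less_base) simp
  have inv: "1 / \<epsilon> > 1" using \<epsilon> by simp
  have "exp 1 < 50 / \<epsilon>" using exp_le inv by simp
  with base have "exp 1 < exp (y / 50)" by linarith
  then have y: "50 < y" by simp
  have "50 * real d \<le> d * y" using y d by simp
  then have "50 * real d \<le> \<epsilon>\<^sup>2 * n" by (simp add: dy)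
  moreover have "\<epsilon>\<^sup>2 * n \<le> n * \<epsilon>" "n * \<epsilon> \<le> n"
    using \<epsilon> mult_right_mono[of \<epsilon> 1 "n * \<epsilon>"] mult_left_mono[of \<epsilon> 1 "real n"]
    by (simp_all add: power2_eq_square mult_ac)
  ultimately show "d \<le> n" "2 * real d \<le> n * \<epsilon>" by linarith+
  \<comment> \<open>In \<open>n / d = y / \<epsilon>\<^sup>2\<close> one factor
    \<open>1 / \<epsilon>\<close> may remain, as it occurs in \<open>R\<close>. The other one and
    the factor \<open>y\<close> are each bounded by a multiple of \<open>exp (y / 8)\<close>, at the
    cost of half the exponent \<open>y / 2\<close>.\<close>
  have "1 / \<epsilon> \<le> exp (y / 50)" using base \<epsilon> by (simp add: field_simps)
  also have "\<dots> \<le> exp (y / 8)" using y by simp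
  finally have "1 / \<epsilon> \<le> exp (y / 8)" .
  moreover have "y / 8 \<le> exp (y / 8)"
    using exp_ge_add_one_self[of "y / 8"] by linarith
  ultimately have "1 / \<epsilon> * (y / 8) \<le> exp (y / 8) * exp (y / 8)"
    using y by (intro mult_mono) auto
  also have "\<dots> = exp (y / 4)" by (simp flip: exp_add)
  finally have ey: "y / \<epsilon> \<le> 8 * exp (y / 4)" by simp
  \<comment> \<open>As \<open>exp 1 \<le> 3\<close>, the constant is at most 48, which fits below
    50.\<close>
  have "2 * exp 1 * (y / \<epsilon>) \<le> 6 * (8 * exp (y / 4))"
    using ey exp_le y \<epsilon> by (intro mult_mono) auto
  also have "\<dots> \<le> 50 * exp (y / 4)" by simp
  finally have "2 * exp 1 * (y / \<epsilon>) * (exp (- (y / 2)) / \<epsilon>) \<le> 50 * exp (y / 4) * (exp (- (y / 2)) / \<epsilon>)"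
    using \<epsilon> by (intro mult_right_mono) auto
  also have "\<dots> = 50 / \<epsilon> * exp (- y / 4)" by (simp flip: exp_add)
  finally have "2 * exp 1 * (y / \<epsilon>\<^sup>2) * exp (- y / 2) \<le> 50 / \<epsilon> * exp (- y / 4)"
    by (simp add: power2_eq_square)
  then have step: "2 * (exp 1 * n / d) * exp (- y / 2) \<le> 50 / \<epsilon> * exp (- y / 4)"
    unfolding n_eq[symmetric] by simp
  have exp_power: "exp (- y / b) ^ d = exp (- (d * y) / b)" for b
    by (simp flip: exp_of_nat_mult)
  \<comment> \<open>Doubling \<open>2 ^ d\<close> lets it join the \<open>d\<close>-th power; the
    factor 2 left over is covered by \<open>50 * real d\<close>.\<close>
  have "(2 ^ d + 1) * (exp 1 * n / d) ^ d * exp (- (\<epsilon>\<^sup>2 * n) / 2)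
      \<le> (2 * 2 ^ d) * (exp 1 * n / d) ^ d * exp (- (\<epsilon>\<^sup>2 * n) / 2)"
    by (intro mult_right_mono) auto
  also have "\<dots> = 2 * (2 * (exp 1 * n / d) * exp (- y / 2)) ^ d"
    unfolding dy power_mult_distrib exp_power by simp
  also have "\<dots> \<le> 2 * (50 / \<epsilon> * exp (- y / 4)) ^ d"
    using step by (intro mult_left_mono power_mono) auto
  also have "\<dots> = 2 * ((50 / \<epsilon>) ^ d * exp (- (d * y) / 4))"
    unfolding power_mult_distrib exp_power ..
  also have "\<dots> \<le> (50 * real d) * ((50 / \<epsilon>) ^ d * exp (- (d * y) / 50))"
    using d \<epsilon> y by (intro mult_mono) auto
  finally show "(2 ^ d + 1) * (exp 1 * n / d) ^ d * exp (- (\<epsilon>\<^sup>2 * n) / 2) \<le> R"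
    by (simp add: R_eq)
qed

section \<open>Queries as boxes and their aggregates\<close>

text \<open>A face is a coordinate with a side, \<open>True\<close> standing for the upper one.
  There are \<open>2 * k\<close> of them, the exponent in the theorem.\<close>

definition box_faces :: "nat \<Rightarrow> (nat \<times> bool) set" where
  "box_faces k = {..<k} \<times> UNIV"

definition face_coord :: "nat \<times> bool \<Rightarrow> (nat \<Rightarrow> real) \<Rightarrow> real" where
  "face_coord f p = (if snd f then p (fst f) else - p (fst f))"

text \<open>Open above and closed below, as the half-open matching condition demands. Both kinds are
  lower sets of \<open>face_coord f\<close>, so the abstract bound treats them alike.\<close>

definition face_half_space :: "(nat \<Rightarrow> real) \<times> (nat \<Rightarrow> real) \<Rightarrow> nat \<times> bool \<Rightarrow> (nat \<Rightarrow> real) set" where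
  "face_half_space q f =
    (if snd f then {p. p (fst f) < fst q (fst f) + snd q (fst f)} else {p. fst q (fst f) \<le> p (fst f)})"

lemma matches_iff_faces: "matches k p q \<longleftrightarrow> (\<forall>f\<in>box_faces k. p \<in> face_half_space q f)"
  by (auto simp: matches_def box_faces_def face_half_space_def split: if_splits)

text \<open>With weights, COUNT and SUM become the same kind of sum over matching points.\<close>

definition agg_weight :: "agg \<Rightarrow> nat \<Rightarrow> (nat \<Rightarrow> real) \<Rightarrow> real" where
  "agg_weight i m p = (case i of Agg_Sum \<Rightarrow> p m | Agg_Count \<Rightarrow> 1)"

lemma f_obs_eq_sum:
  "f_obs i k m n D q = (\<Sum>l<n. if matches k (D l) q then agg_weight i m (D l) else 0)"
proof (cases i)
  case Agg_Count
  have "real (card {l. l < n \<and> matches k (D l) q}) = (\<Sum>l\<in>{l. l < n \<and> matches k (D l) q}. 1)"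
    by simp
  also have "\<dots> = (\<Sum>l<n. if matches k (D l) q then 1 else 0)"
    by (intro sum.mono_neutral_cong_left) auto
  finally show ?thesis unfolding Agg_Count f_obs_def agg_weight_def agg.case by simp
next
  case Agg_Sum
  show ?thesis unfolding Agg_Sum f_obs_def agg_weight_def agg.case ..
qed

text \<open>Points lie in the cube only almost surely, whereas the deviation bound asks for weights
  in [0,1] everywhere. Clipping alters nothing on the cube.\<close>

definition clip :: "real \<Rightarrow> real" where "clip x = max 0 (min 1 x)"

text \<open>The data points have identical laws, so by linearity the expected query value is
  \<open>n\<close> times a one-point mean. The clipped weight replaces the original one because
  almost every database lies in the cube.\<close>

lemma
  assumes chi: "prob_space chi" "sets chi = sets (PiM {..<k} (\<lambda>_. borel))" and m: "m < k"
    and cube: "AE p in chi. \<forall>j<k. 0 \<le> p j \<and> p j \<le> 1"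
  shows f_dist_eq: "f_dist i k m n chi q =
    n * (\<integral>p. (if matches k p q then clip (agg_weight i m p) else 0) \<partial>chi)"
    and borel_measurable_agg_weight: "(\<lambda>p. agg_weight i m p) \<in> borel_measurable chi"
    and sets_matches: "{p\<in>space chi. matches k p q} \<in> sets chi"
    and AE_db_measure_in_cube: "AE D in db_measure n chi. \<forall>l<n. \<forall>j<k. 0 \<le> D l j \<and> D l j \<le> 1"
proof -
  interpret chi: prob_space chi by fact
  interpret product_prob_space "\<lambda>_. chi" "{..<n}" ..
  have coord: "(\<lambda>p. p j) \<in> borel_measurable chi" if "j < k" for j
    using that chi(2) by (subst measurable_cong_sets[OF chi(2) refl]) auto
  show weight: "(\<lambda>p. agg_weight i m p) \<in> borel_measurable chi"
    using coord[OF m] by (cases i) (simp_all add: agg_weight_def)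
  have "Measurable.pred chi (\<lambda>p. \<forall>j\<in>{..<k}. \<not> p j < fst q j \<and> p j < fst q j + snd q j)"
    by (intro pred_intros_finite(3) pred_intros_logic(2,3) borel_measurable_pred_less coord) auto
  moreover have "{p\<in>space chi. matches k p q} =
      {p\<in>space chi. \<forall>j\<in>{..<k}. \<not> p j < fst q j \<and> p j < fst q j + snd q j}"
    by (auto simp: matches_def not_less)
  ultimately show match: "{p\<in>space chi. matches k p q} \<in> sets chi"
    unfolding Measurable.pred_def by metis
  show AE: "AE D in db_measure n chi. \<forall>l<n. \<forall>j<k. 0 \<le> D l j \<and> D l j \<le> 1"
  proof -
    have "AE D in PiM {..<n} (\<lambda>_. chi). \<forall>l\<in>{..<n}. \<forall>j<k. 0 \<le> D l j \<and> D l j \<le> 1"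
    proof (rule AE_finite_allI)
      fix l assume "l \<in> {..<n}"
      then show "AE D in PiM {..<n} (\<lambda>_. chi). \<forall>j<k. 0 \<le> D l j \<and> D l j \<le> 1"
        using AE_component[of l "\<lambda>p. \<forall>j<k. 0 \<le> p j \<and> p j \<le> 1"] cube by simp
    qed simp
    then show ?thesis unfolding db_measure_def Ball_def lessThan_iff .
  qed
  define w where "w = (\<lambda>p. if matches k p q then agg_weight i m p else 0)"
  define c where "c = (\<lambda>p. if matches k p q then clip (agg_weight i m p) else 0)"
  have [measurable]: "w \<in> borel_measurable chi" "c \<in> borel_measurable chi"
    using weight match unfolding w_def c_def clip_def by measurable
  have c01: "0 \<le> c p" "c p \<le> 1" for p by (auto simp: c_def clip_def)
  have int_l: "integrable (PiM {..<n} (\<lambda>_. chi)) (\<lambda>D. c (D l))"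
      "(\<integral>D. c (D l) \<partial>PiM {..<n} (\<lambda>_. chi)) = (\<integral>p. c p \<partial>chi)" if "l < n" for l
  proof -
    show "integrable (PiM {..<n} (\<lambda>_. chi)) (\<lambda>D. c (D l))"
      using c01 that by (intro P.integrable_const_bound[of _ 1]) auto
    have "(\<integral>p. c p \<partial>chi) = (\<integral>p. c p \<partial>distr (PiM {..<n} (\<lambda>_. chi)) chi (\<lambda>D. D l))"
      using that by (simp add: PiM_component)
    also have "\<dots> = (\<integral>D. c (D l) \<partial>PiM {..<n} (\<lambda>_. chi))"
      using that by (intro integral_distr) auto
    finally show "(\<integral>D. c (D l) \<partial>PiM {..<n} (\<lambda>_. chi)) = (\<integral>p. c p \<partial>chi)" ..
  qed
  have "f_dist i k m n chi q = (\<integral>D. (\<Sum>l<n. w (D l)) \<partial>PiM {..<n} (\<lambda>_. chi))"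
    by (simp add: f_dist_def f_obs_eq_sum w_def db_measure_def)
  also have "\<dots> = (\<integral>D. (\<Sum>l<n. c (D l)) \<partial>PiM {..<n} (\<lambda>_. chi))"
  proof (rule integral_cong_AE)
    show "AE D in PiM {..<n} (\<lambda>_. chi). (\<Sum>l<n. w (D l)) = (\<Sum>l<n. c (D l))"
      using AE unfolding db_measure_def
    proof eventually_elim
      case (elim D)
      then show ?case
        using m by (intro sum.cong) (auto simp: w_def c_def clip_def agg_weight_def split: agg.splits)
    qed
  qed measurable
  also have "\<dots> = n * (\<integral>p. c p \<partial>chi)"
    using int_l by simp
  finally show "f_dist i k m n chi q =
    n * (\<integral>p. (if matches k p q then clip (agg_weight i m p) else 0) \<partial>chi)"
    by (simp add: c_def)
qed

section \<open>The tail bound for the supremum over all queries\<close>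

lemma sup_norm_le:
  assumes "\<And>q. q \<in> queries k \<Longrightarrow> \<bar>g q\<bar> \<le> B"
  shows "sup_norm k g \<le> B"
  unfolding sup_norm_def
proof (rule cSUP_least)
  have "(\<lambda>_. 0, \<lambda>_. 0) \<in> queries k" by (simp add: queries_def)
  then show "queries k \<noteq> {}" by blast
qed (use assms in auto)

theorem theorem3p5:
  shows "\<exists>\<kappa>::real. \<kappa> > 0 \<and>
    (\<forall>(dbar::nat) (m::nat) (n::nat) (chi::(nat \<Rightarrow> real) measure) (\<epsilon>::real) (i::agg).
      1 \<le> dbar \<longrightarrow> m < dbar \<longrightarrow>
      prob_space chi \<longrightarrow>
      sets chi = sets (PiM {..<dbar} (\<lambda>_. borel)) \<longrightarrow>
      (AE p in chi. \<forall>j<dbar. 0 \<le> p j \<and> p j \<le> 1) \<longrightarrow>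
      \<epsilon> > 0 \<longrightarrow>
      (\<exists>A \<in> sets (db_measure n chi).
         {D \<in> space (db_measure n chi).
            (1 / real n) * sup_norm dbar (\<lambda>q. f_dist i dbar m n chi q - f_obs i dbar m n D q) > \<epsilon>} \<subseteq> A
         \<and> measure (db_measure n chi) A
             \<le> \<kappa> ^ (2 * dbar + 1) * real (2 * dbar) * \<epsilon> powi (- int (2 * dbar))
                * exp (- (\<epsilon>\<^sup>2 * real n) / \<kappa>)))"
proof (intro exI[of _ 50] conjI allI impI)
  \<comment> \<open>The constant is the one for which \<open>tail_bound_absorbs_counting\<close>
    works.\<close>
  show "(0 :: real) < 50" by simp
next
  fix k m n :: nat and chi :: "(nat \<Rightarrow> real) measure" and \<epsilon> :: real and i :: agg
  assume k: "1 \<le> k" and m: "m < k" and chi: "prob_space chi" "sets chi = sets (PiM {..<k} (\<lambda>_. borel))"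
    and cube: "AE p in chi. \<forall>j<k. 0 \<le> p j \<and> p j \<le> 1" and \<epsilon>: "0 < \<epsilon>"
  interpret chi: prob_space chi by fact
  interpret DB: prob_space "db_measure n chi"
    unfolding db_measure_def by (intro prob_space_PiM chi)
  define R where "R = 50 ^ (2 * k + 1) * real (2 * k) * \<epsilon> powi (- int (2 * k))
                * exp (- (\<epsilon>\<^sup>2 * real n) / 50)"
  have "0 \<le> R" using \<epsilon> by (simp add: R_def)
  \<comment> \<open>The supremum runs over uncountably many queries, so \<open>fails\<close> is
    enclosed in a measurable set rather than measured itself.\<close>
  define fails where "fails = {D \<in> space (db_measure n chi).
            (1 / real n) * sup_norm k (\<lambda>q. f_dist i k m n chi q - f_obs i k m n D q) > \<epsilon>}"
  define c where "c = (\<lambda>q p. if matches k p q then clip (agg_weight i m p) else 0)"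
  \<comment> \<open>One null set contains all databases that leave the cube. Outside it clipping
    changes no weight, whatever the query.\<close>
  obtain N where N: "N \<in> null_sets (db_measure n chi)"
    and "{D \<in> space (db_measure n chi). \<not> (\<forall>l<n. \<forall>j<k. 0 \<le> D l j \<and> D l j \<le> 1)} \<subseteq> N"
    using AE_db_measure_in_cube[OF chi m cube, of n] by (auto simp: eventually_ae_filter)
  then have good: "0 \<le> D l j \<and> D l j \<le> 1"
    if "D \<in> space (db_measure n chi) - N" "l < n" "j < k" for D l j
    using that by blast
  have dev: "f_dist i k m n chi q - f_obs i k m n D q = n * (\<integral>p. c q p \<partial>chi) - (\<Sum>l<n. c q (D l))"
    if D: "D \<in> space (db_measure n chi) - N" for D q
  proof -
    have "f_obs i k m n D q = (\<Sum>l<n. c q (D l))"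
      unfolding f_obs_eq_sum using good[OF D _ m]
      by (intro sum.cong) (auto simp: c_def clip_def agg_weight_def split: agg.splits)
    then show ?thesis by (simp add: f_dist_eq[OF chi m cube] c_def)
  qed
  have failsI: "fails \<subseteq> A \<union> N" if "0 < n"
    and A: "\<And>D q. D \<in> space (db_measure n chi) - N \<Longrightarrow> D \<notin> A \<Longrightarrow>
      \<bar>n * (\<integral>p. c q p \<partial>chi) - (\<Sum>l<n. c q (D l))\<bar> \<le> n * \<epsilon>" for A
  proof
    fix D assume D: "D \<in> fails"
    show "D \<in> A \<union> N"
    proof (rule ccontr)
      assume "D \<notin> A \<union> N"
      then have "sup_norm k (\<lambda>q. f_dist i k m n chi q - f_obs i k m n D q) \<le> n * \<epsilon>"
        using A D dev by (intro sup_norm_le) (auto simp: fails_def)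
      then show False using D \<open>0 < n\<close> by (simp add: fails_def field_simps)
    qed
  qed
  have c_int: "integrable chi (c q)" for q
  proof (intro chi.integrable_const_bound[of _ 1])
    show "c q \<in> borel_measurable chi"
      using borel_measurable_agg_weight[OF chi m cube, of i] sets_matches[OF chi m cube, of q] unfolding c_def clip_def by measurable
  qed (auto simp: c_def clip_def)
  have c01: "0 \<le> c q p" "c q p \<le> 1" for q p by (auto simp: c_def clip_def)
  \<comment> \<open>For \<open>n = 0\<close> the quotient \<open>1 / real n\<close> is 0 and nothing
    fails; for \<open>1 \<le> R\<close> the whole space serves; for
    \<open>1 \<le> \<epsilon>\<close> both terms lie between 0 and \<open>n\<close>, so a failure
    can occur only on \<open>N\<close>. The last case uses the uniform bound.\<close>
  consider "n = 0" | "1 \<le> R" | "0 < n" "1 \<le> \<epsilon>" | "0 < n" "\<epsilon> < 1" "R < 1" by linarith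
  then have "\<exists>A \<in> sets (db_measure n chi). fails \<subseteq> A \<and> DB.prob A \<le> R"
  proof cases
    case 1
    then show ?thesis using \<epsilon> \<open>0 \<le> R\<close> by (intro bexI[of _ "{}"]) (auto simp: fails_def)
  next
    case 2
    then show ?thesis
      by (intro bexI[of _ "space (db_measure n chi)"]) (auto simp: fails_def DB.prob_space)
  next
    case 3
    have "\<bar>n * (\<integral>p. c q p \<partial>chi) - (\<Sum>l<n. c q (D l))\<bar> \<le> n * \<epsilon>" for D q
    proof -
      have "0 \<le> (\<integral>p. c q p \<partial>chi)" "(\<integral>p. c q p \<partial>chi) \<le> 1"
        using c01 chi.integral_le_const[OF c_int, of q 1] by auto
      then have "0 \<le> n * (\<integral>p. c q p \<partial>chi)" "n * (\<integral>p. c q p \<partial>chi) \<le> n"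
        by (auto intro: mult_left_le)
      moreover have "0 \<le> (\<Sum>l<n. c q (D l))" "(\<Sum>l<n. c q (D l)) \<le> n"
        using sum_nonneg[of "{..<n}" "\<lambda>l. c q (D l)"]
          sum_bounded_above[of "{..<n}" "\<lambda>l. c q (D l)" 1] c01 by simp_all
      moreover have "real n \<le> n * \<epsilon>" using 3 by simp
      ultimately show ?thesis by linarith
    qed
    then have "fails \<subseteq> {} \<union> N" using 3 by (intro failsI) auto
    then show ?thesis
      using N \<open>0 \<le> R\<close> by (intro bexI[of _ N]) (auto simp: measure_def)
  next
    case 4
    have card: "card (box_faces k) = 2 * k"
      by (simp add: box_faces_def card_cartesian_product)
    then have box_nonempty: "box_faces k \<noteq> {}" using k by auto
    have tail: "2 * k \<le> n" "2 * real (2 * k) \<le> n * \<epsilon>"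
      "(2 ^ (2 * k) + 1) * (exp 1 * n / (2 * k)) ^ (2 * k) * exp (- (\<epsilon>\<^sup>2 * n) / 2) \<le> R"
      using tail_bound_absorbs_counting[of "2 * k" \<epsilon> n] k \<epsilon> 4 unfolding R_def by simp_all
    have "face_coord f \<in> borel_measurable chi" if "f \<in> box_faces k" for f
    proof -
      have "(\<lambda>p. p (fst f)) \<in> borel_measurable chi"
        using that by (subst measurable_cong_sets[OF chi(2) refl]) (auto simp: box_faces_def)
      then show ?thesis by (cases "snd f") (simp_all add: face_coord_def[abs_def])
    qed
    moreover have "(\<lambda>p. clip (agg_weight i m p)) \<in> borel_measurable chi"
      using borel_measurable_agg_weight[OF chi m cube, of i] unfolding clip_def by measurable
    ultimately have "\<exists>A\<in>sets (PiM {..<n} (\<lambda>_. chi)).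
      measure (PiM {..<n} (\<lambda>_. chi)) A \<le>
        (2 ^ card (box_faces k) + 1) * (exp 1 * n / card (box_faces k)) ^ card (box_faces k) *
          exp (- (\<epsilon>\<^sup>2 * n) / 2) \<and>
      (\<forall>D\<in>space (PiM {..<n} (\<lambda>_. chi)) - A. \<forall>C.
        (\<forall>f\<in>box_faces k. \<forall>p\<in>C f. \<forall>x. x \<notin> C f \<longrightarrow> face_coord f p < face_coord f x) \<longrightarrow>
        {x\<in>space chi. \<forall>f\<in>box_faces k. x \<in> C f} \<in> sets chi \<longrightarrow>
        \<bar>(\<Sum>l<n. if \<forall>f\<in>box_faces k. D l \<in> C f then clip (agg_weight i m (D l)) else 0) -
          n * (\<integral>x. (if \<forall>f\<in>box_faces k. x \<in> C f then clip (agg_weight i m x) else 0) \<partial>chi)\<bar> \<le> n * \<epsilon>)"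
      using tail k \<epsilon> chi(1)
      by (intro uniform_deviation_down_sets)
        (use box_nonempty in \<open>auto simp: card clip_def\<close>, auto simp: box_faces_def)
    then obtain A where A: "A \<in> sets (db_measure n chi)"
      and prob: "DB.prob A \<le> (2 ^ card (box_faces k) + 1) *
        (exp 1 * n / card (box_faces k)) ^ card (box_faces k) * exp (- (\<epsilon>\<^sup>2 * n) / 2)"
      and unif: "\<And>D C. D \<in> space (db_measure n chi) - A \<Longrightarrow>
        \<forall>f\<in>box_faces k. \<forall>p\<in>C f. \<forall>x. x \<notin> C f \<longrightarrow> face_coord f p < face_coord f x \<Longrightarrow>
        {x\<in>space chi. \<forall>f\<in>box_faces k. x \<in> C f} \<in> sets chi \<Longrightarrow>
        \<bar>(\<Sum>l<n. if \<forall>f\<in>box_faces k. D l \<in> C f then clip (agg_weight i m (D l)) else 0) -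
          n * (\<integral>x. (if \<forall>f\<in>box_faces k. x \<in> C f then clip (agg_weight i m x) else 0) \<partial>chi)\<bar> \<le> n * \<epsilon>"
      unfolding db_measure_def by blast
    have "\<bar>n * (\<integral>p. c q p \<partial>chi) - (\<Sum>l<n. c q (D l))\<bar> \<le> n * \<epsilon>"
      if "D \<in> space (db_measure n chi) - A" for D q
      using unif[OF that, of "face_half_space q"] sets_matches[OF chi m cube, of q]
      unfolding c_def matches_iff_faces
      by (simp add: abs_minus_commute) (auto simp: face_half_space_def face_coord_def)
    then have "fails \<subseteq> A \<union> N" using 4 by (intro failsI) auto
    moreover have "DB.prob (A \<union> N) \<le> R"
    proof -
      have "DB.prob (A \<union> N) \<le> DB.prob A + DB.prob N"
        using A N by (intro measure_Un_le) auto
      also have "DB.prob N = 0" using N by (auto simp: measure_def)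
      finally show ?thesis using prob tail(3) by (simp add: card)
    qed
    ultimately show ?thesis using A N by (intro bexI[of _ "A \<union> N"]) auto
  qed
  then show "\<exists>A \<in> sets (db_measure n chi).
         {D \<in> space (db_measure n chi).
            (1 / real n) * sup_norm k (\<lambda>q. f_dist i k m n chi q - f_obs i k m n D q) > \<epsilon>} \<subseteq> A
         \<and> measure (db_measure n chi) A
             \<le> 50 ^ (2 * k + 1) * real (2 * k) * \<epsilon> powi (- int (2 * k))
                * exp (- (\<epsilon>\<^sup>2 * real n) / 50)"
    by (simp only: fails_def R_def)
qed

end
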